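(* Let $\alpha=(a_1,\dots,a_n)\in\mathrm{UPF}_n$ and let $m=|L(\alpha)|$, where $L(\alpha)$ is the set of lucky cars of $\alpha$. List the lucky cars in two orders: by increasing car index, $u_1<u_2<\dots<u_m$; and by increasing preference value, $w_1,w_2,\dots,w_m$, so that $a_{w_1}<a_{w_2}<\dots<a_{w_m}$ (the second order is well defined, since the preferences of the lucky cars are the distinct block starts $\nu_1<\dots<\nu_m$ of $\alpha$). Then $\alpha\in\mathrm{DUPF}_n$ if and only if $u_k\ne w_k$ for all $k\in[m]$.
   Context: $[n]=\{1,\dots,n\}$. A tuple $\alpha=(a_1,\dots,a_n)\in[n]^n$ is a parking function if, when cars $1,\dots,n$ enter in this order a one-way street with spots $1,\dots,n$ and car $i$ parks in the first free spot $s_i\ge a_i$, all cars manage to park. $\mathrm{UPF}_n$ (unit-interval parking functions) is the set of parking functions of length $n$ with $s_i-a_i\in\{0,1\}$ for all $i$; $\mathrm{UPF}_0$ consists of the empty tuple. Car $i$ is lucky if $s_i=a_i$, and $L(\alpha)\subseteq[n]$ is the set of lucky cars. Block structure: for $\alpha\in\mathrm{UPF}_n$ let $(a^\uparrow_1,\dots,a^\uparrow_n)$ be its weakly increasing rearrangement, let $\nu_1<\dots<\nu_m$ be the indices $i$ with $a^\uparrow_i=i$ (block starts), and put $\nu_{m+1}=n+1$. The car set of block $j$ is $I_j=\{i\in[n]:\nu_j\le a_i<\nu_{j+1}\}$. Set $\phi(\alpha)=(I_1,\dots,I_m)$, an ordered set partition of $[n]$. An ordered set partition $(C_1,\dots,C_k)$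 of $[n]$ (nonempty disjoint blocks with union $[n]$), whose blocks listed by increasing minimum element are $B_1,\dots,B_k$, is deranged if $C_i\ne B_i$ for all $i\in[k]$ (the empty ordered set partition of $\emptyset$ is deranged). $\mathrm{DUPF}_n$ is the set of $\alpha\in\mathrm{UPF}_n$ such that $\phi(\alpha)$ is deranged. *)

theory Defs
  imports Main "HOL-Library.Disjoint_Sets"
begin

text \<open>
  Tuples \<open>(a\<^sub>1,\<dots>,a\<^sub>n)\<close> are lists of length \<open>n\<close>. Cars, spots and preferences are numbered from \<open>1\<close>,
  whereas \<open>!\<close> counts list positions from \<open>0\<close>.
\<close>

definition pref :: "nat list \<Rightarrow> nat \<Rightarrow> nat" where
  "pref \<alpha> i = \<alpha> ! (i - 1)"

text \<open>
  \<open>park n occ as\<close> lists the outcomes when cars with preferences \<open>as\<close> enter a street with spots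
  \<open>1,\<dots>,n\<close> of which those in \<open>occ\<close> are already taken; \<open>None\<close> means that the car finds no free spot.
\<close>

fun park :: "nat \<Rightarrow> nat set \<Rightarrow> nat list \<Rightarrow> nat option list" where
  "park n occ [] = []"
| "park n occ (a # as) =
    (case find (\<lambda>s. s \<notin> occ) [a..<Suc n] of
       None \<Rightarrow> None # park n occ as
     | Some s \<Rightarrow> Some s # park n (insert s occ) as)"

definition outcome :: "nat list \<Rightarrow> nat option list" where
  "outcome \<alpha> = park (length \<alpha>) {} \<alpha>"

text \<open>Only meaningful if car \<open>i\<close> does park.\<close>

definition spot :: "nat list \<Rightarrow> nat \<Rightarrow> nat" where
  "spot \<alpha> i = the (outcome \<alpha> ! (i - 1))"

definition PF :: "nat \<Rightarrow> nat list set" where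
  "PF n = {\<alpha>. length \<alpha> = n \<and> set \<alpha> \<subseteq> {1..n} \<and> None \<notin> set (outcome \<alpha>)}"

definition UPF :: "nat \<Rightarrow> nat list set" where
  "UPF n = {\<alpha> \<in> PF n. \<forall>i\<in>{1..n}. int (spot \<alpha> i) - int (pref \<alpha> i) \<in> {0, 1}}"

definition lucky :: "nat list \<Rightarrow> nat set" where
  "lucky \<alpha> = {i \<in> {1..length \<alpha>}. spot \<alpha> i = pref \<alpha> i}"

text \<open>The list \<open>[\<nu>\<^sub>1, \<dots>, \<nu>\<^sub>m]\<close>, without the sentinel \<open>\<nu>\<^sub>m\<^sub>+\<^sub>1 = n + 1\<close>.\<close>

definition block_starts :: "nat list \<Rightarrow> nat list" where
  "block_starts \<alpha> = sorted_list_of_set {i \<in> {1..length \<alpha>}. pref (sort \<alpha>) i = i}"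

definition phi :: "nat list \<Rightarrow> nat set list" where
  "phi \<alpha> =
    (let \<nu> = block_starts \<alpha> @ [length \<alpha> + 1]
     in map (\<lambda>j. {i \<in> {1..length \<alpha>}. \<nu> ! j \<le> pref \<alpha> i \<and> pref \<alpha> i < \<nu> ! Suc j})
          [0..<length (block_starts \<alpha>)])"

definition ordered_set_partition :: "nat \<Rightarrow> nat set list \<Rightarrow> bool" where
  "ordered_set_partition n Cs \<longleftrightarrow> distinct Cs \<and> partition_on {1..n} (set Cs)"

definition deranged :: "nat \<Rightarrow> nat set list \<Rightarrow> bool" where
  "deranged n Cs \<longleftrightarrow> ordered_set_partition n Cs \<and>
     (let Bs = sort_key Min Cs in \<forall>i<length Cs. Cs ! i \<noteq> Bs ! i)"

definition DUPF :: "nat \<Rightarrow> nat list set" where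
  "DUPF n = {\<alpha> \<in> UPF n. deranged n (phi \<alpha>)}"

end

theory Submission
  imports Defs "HOL-Library.Multiset"
begin

text \<open>
  In a unit-interval parking function the spot assignment is a bijection of \<open>[n]\<close>, and the car in
  spot \<open>t\<close> prefers \<open>t\<close> or \<open>t - 1\<close>. Hence the number of preferences below \<open>t\<close> is \<open>t - 1\<close> or \<open>t\<close>, the
  former exactly if the car in spot \<open>t\<close> is lucky; so the block starts are the preferences of the
  lucky cars. An unlucky car was preceded by the car that took its preferred spot, which belongs to
  the same block; descending along such cars ends at the lucky car of the block, which is therefore
  its minimum. The disjoint blocks being determined by their minima, comparing \<open>\<phi>(\<alpha>)\<close> with its
  rearrangement by increasing minimum amounts to comparing \<open>w\<close> with \<open>u\<close>.
\<close>

section \<open>The parking process\<close>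

lemma find_upt_SomeD:
  assumes "find P [a..<b] = Some s"
  shows "a \<le> s" "s < b" "P s" "\<And>t. a \<le> t \<Longrightarrow> t < s \<Longrightarrow> \<not> P t"
proof -
  obtain i where i: "i < b - a" "P (a + i)" "s = a + i" "\<And>j. j < i \<Longrightarrow> \<not> P (a + j)"
    using assms by (auto simp: find_Some_iff)
  show "a \<le> s" "s < b" "P s" using i by auto
  show "\<not> P t" if "a \<le> t" "t < s" for t
    using i(4)[of "t - a"] that i(3) by auto
qed

text \<open>Stated for an arbitrary set \<open>occ\<close> because the recursion of
  \<open>park\<close> enlarges it. The last conjunct records that every spot a car passes is taken;
  this is what later provides an unlucky car with a predecessor.\<close>

lemma park_nth:
  assumes "None \<notin> set (park n occ as)" and "k < length as"
  defines "s \<equiv> \<lambda>k. the (park n occ as ! k)"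
  shows "s k \<notin> occ \<union> s ` {..<k} \<and> as ! k \<le> s k \<and> s k \<le> n \<and> {as ! k..<s k} \<subseteq> occ \<union> s ` {..<k}"
  using assms(1,2) unfolding s_def
proof (induction as arbitrary: occ k)
  case Nil
  then show ?case by simp
next
  case (Cons a as)
  then obtain t where t: "find (\<lambda>s. s \<notin> occ) [a..<Suc n] = Some t"
    by (cases "find (\<lambda>s. s \<notin> occ) [a..<Suc n]") auto
  have park: "park n occ (a # as) = Some t # park n (insert t occ) as"
    using t by (simp del: upt_Suc)
  show ?case
  proof (cases k)
    case 0
    then show ?thesis
      unfolding park using find_upt_SomeD[OF t] by (fastforce simp del: upt_Suc)
  next
    case (Suc k')
    have "None \<notin> set (park n (insert t occ) as)" "k' < length as"
      using Cons.prems Suc by (auto simp: park simp del: park.simps)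
    \<comment> \<open>The spot \<open>t\<close> of the first car is value \<open>0\<close> of the
      shifted sequence; it moves from the image into the occupied set.\<close>
    from Cons.IH[OF this] show ?thesis
      unfolding park Suc lessThan_Suc_eq_insert_0 by (simp add: image_image)
  qed
qed

section \<open>Order statistics by counting\<close>

lemma sorted_nth_le_iff:
  assumes "sorted xs" and "k < length xs"
  shows "xs ! k \<le> t \<longleftrightarrow> k < length (filter (\<lambda>x. x \<le> t) xs)"
  using assms
proof (induction xs arbitrary: k)
  case Nil
  then show ?case by simp
next
  case (Cons x xs)
  show ?case
  proof (cases "x \<le> t")
    case True
    then show ?thesis using Cons by (cases k) auto
  next
    case False
    then have "filter (\<lambda>x. x \<le> t) (x # xs) = []"
      using Cons.prems(1) by (fastforce simp: filter_empty_conv)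
    moreover have "x \<le> (x # xs) ! k"
      using Cons.prems by (cases k) auto
    ultimately show ?thesis using False by auto
  qed
qed

text \<open>Entries up to \<open>t\<close> form an initial segment of the sorted list, and sorting
  preserves their number. Thus questions about the rearrangement become counts over the original
  list.\<close>

lemma sort_nth_le_iff:
  fixes xs :: "'a::linorder list"
  assumes "k < length xs"
  shows "sort xs ! k \<le> t \<longleftrightarrow> k < card {i. i < length xs \<and> xs ! i \<le> t}"
proof -
  have "length (filter (\<lambda>x. x \<le> t) (sort xs)) = length (filter (\<lambda>x. x \<le> t) xs)"
    by (simp add: filter_sort)
  then show ?thesis
    using sorted_nth_le_iff[of "sort xs" k t] assms by (simp add: length_filter_conv_card)
qed

lemma map_sort_key_eq_sort: "map f (sort_key f xs) = sort (map f xs)"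
  by (rule properties_for_sort[symmetric]) simp_all

section \<open>Spots and lucky cars\<close>

context
  fixes n :: nat and \<alpha> :: "nat list"
  assumes UPF: "\<alpha> \<in> UPF n"
begin

lemma length_UPF: "length \<alpha> = n"
  using UPF by (simp add: UPF_def PF_def)

lemma pref_in: "i \<in> {1..n} \<Longrightarrow> pref \<alpha> i \<in> {1..n}"
proof -
  assume i: "i \<in> {1..n}"
  then have "pref \<alpha> i \<in> set \<alpha>" unfolding pref_def using length_UPF by auto
  then show ?thesis using UPF by (auto simp: UPF_def PF_def)
qed

lemma spot_unit: "i \<in> {1..n} \<Longrightarrow> spot \<alpha> i = pref \<alpha> i \<or> spot \<alpha> i = Suc (pref \<alpha> i)"
  using UPF by (fastforce simp: UPF_def)

lemma spot_parked:
  assumes "i \<in> {1..n}"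
  shows "spot \<alpha> i \<notin> spot \<alpha> ` {1..<i}" and "spot \<alpha> i \<in> {1..n}"
    and "{pref \<alpha> i..<spot \<alpha> i} \<subseteq> spot \<alpha> ` {1..<i}"
proof -
  define s where "s = (\<lambda>k. the (park n {} \<alpha> ! k))"
  have "None \<notin> set (park n {} \<alpha>)"
    using UPF length_UPF by (simp add: UPF_def PF_def outcome_def)
  moreover have "i - 1 < length \<alpha>" using assms length_UPF by auto
  ultimately have *: "s (i - 1) \<notin> s ` {..<i - 1}" "pref \<alpha> i \<le> s (i - 1)" "s (i - 1) \<le> n"
      "{pref \<alpha> i..<s (i - 1)} \<subseteq> s ` {..<i - 1}"
    using park_nth[of n "{}" \<alpha> "i - 1"] by (simp_all add: s_def pref_def)
  have s: "spot \<alpha> j = s (j - 1)" for j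
    by (simp add: spot_def outcome_def length_UPF s_def)
  \<comment> \<open>Cars count from \<open>1\<close>, list positions from \<open>0\<close>.\<close>
  have "{1..<i} = Suc ` {..<i - 1}"
    using assms by (cases i) (auto simp: image_Suc_lessThan)
  then have im: "spot \<alpha> ` {1..<i} = s ` {..<i - 1}"
    by (simp only: image_image s diff_Suc_1)
  show "spot \<alpha> i \<notin> spot \<alpha> ` {1..<i}" "{pref \<alpha> i..<spot \<alpha> i} \<subseteq> spot \<alpha> ` {1..<i}"
    using * im by (simp_all add: s)
  show "spot \<alpha> i \<in> {1..n}" using * pref_in[OF assms] by (simp add: s)
qed

text \<open>Of two cars the later one avoids the spot of the earlier; an injection of a finite set
  into itself is onto.\<close>

lemma bij_betw_spot: "bij_betw (spot \<alpha>) {1..n} {1..n}"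
proof -
  have inj: "inj_on (spot \<alpha>) {1..n}"
  proof (rule linorder_inj_onI')
    fix i j assume "i \<in> {1..n}" "j \<in> {1..n}" "i < j"
    then show "spot \<alpha> i \<noteq> spot \<alpha> j"
      using spot_parked(1)[of j] by (metis atLeastAtMost_iff atLeastLessThan_iff image_eqI)
  qed
  moreover have "spot \<alpha> ` {1..n} \<subseteq> {1..n}" using spot_parked(2) by blast
  ultimately show ?thesis
    by (simp add: bij_betw_def endo_inj_surj)
qed

lemma spot_eqD:
  "i \<in> {1..n} \<Longrightarrow> j \<in> {1..n} \<Longrightarrow> spot \<alpha> i = spot \<alpha> j \<Longrightarrow> i = j"
  by (rule inj_onD[OF bij_betw_imp_inj_on[OF bij_betw_spot]])

text \<open>An unlucky car parks one past its preference, so it passed exactly its preferred spot,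
  which an earlier car had taken. This is the descent step for block minima.\<close>

lemma unlucky_obtains:
  assumes "i \<in> {1..n}" and "i \<notin> lucky \<alpha>"
  obtains j where "j \<in> {1..<i}" and "spot \<alpha> j = pref \<alpha> i"
proof -
  have "spot \<alpha> i = Suc (pref \<alpha> i)"
    using assms spot_unit[of i] by (auto simp: lucky_def length_UPF)
  then have "pref \<alpha> i \<in> spot \<alpha> ` {1..<i}" using spot_parked(3)[OF assms(1)] by auto
  then show ?thesis using that by auto
qed

lemma luckyD: "i \<in> lucky \<alpha> \<Longrightarrow> i \<in> {1..n} \<and> spot \<alpha> i = pref \<alpha> i"
  by (simp add: lucky_def length_UPF)

lemma finite_lucky: "finite (lucky \<alpha>)"
  by (simp add: lucky_def)

lemma inj_on_pref_lucky: "inj_on (pref \<alpha>) (lucky \<alpha>)"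
  by (rule inj_onI) (metis luckyD spot_eqD)

section \<open>Block starts as preferences of lucky cars\<close>

lemma card_spot_le:
  assumes "t \<le> n"
  shows "card {i \<in> {1..n}. spot \<alpha> i \<le> t} = t"
proof -
  have "spot \<alpha> ` {i \<in> {1..n}. spot \<alpha> i \<le> t} = spot \<alpha> ` {1..n} \<inter> {..t}" by auto
  also have "\<dots> = {1..t}" using bij_betw_spot assms by (auto simp: bij_betw_def)
  finally have "bij_betw (spot \<alpha>) {i \<in> {1..n}. spot \<alpha> i \<le> t} {1..t}"
    using bij_betw_spot by (auto simp: bij_betw_def intro: inj_on_subset)
  then have "card {i \<in> {1..n}. spot \<alpha> i \<le> t} = card {1..t}" by (rule bij_betw_same_card)
  then show ?thesis by simp
qed

lemma sort_pref_le_iff: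
  assumes "i \<in> {1..n}"
  shows "pref (sort \<alpha>) i \<le> t \<longleftrightarrow> i \<le> card {j \<in> {1..n}. pref \<alpha> j \<le> t}"
proof -
  have "bij_betw Suc {j. j < n \<and> \<alpha> ! j \<le> t} {j \<in> {1..n}. pref \<alpha> j \<le> t}"
    by (rule bij_betwI[where g = "\<lambda>j. j - 1"]) (auto simp: pref_def)
  then have "card {j. j < n \<and> \<alpha> ! j \<le> t} = card {j \<in> {1..n}. pref \<alpha> j \<le> t}"
    by (rule bij_betw_same_card)
  moreover have "i - 1 < length \<alpha>" using assms length_UPF by auto
  then have "pref (sort \<alpha>) i \<le> t \<longleftrightarrow> i - 1 < card {j. j < n \<and> \<alpha> ! j \<le> t}"
    unfolding pref_def by (simp only: sort_nth_le_iff length_UPF)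
  ultimately show ?thesis using assms by auto
qed

lemma sort_pref_fixed_iff:
  assumes "spot \<alpha> c = t" and "c \<in> {1..n}"
  shows "pref (sort \<alpha>) t = t \<longleftrightarrow> c \<in> lucky \<alpha>"
proof -
  have t: "t \<in> {1..n}" using spot_parked(2) assms by auto
  \<comment> \<open>Cars parked below \<open>t\<close> also prefer a spot below \<open>t\<close>. A
    further car in \<open>A\<close> must move up to spot \<open>t\<close> itself, so only
    \<open>c\<close> can be one, and it is one exactly when unlucky.\<close>
  define A where "A = {j \<in> {1..n}. pref \<alpha> j \<le> t - 1}"
  define S where "S = {j \<in> {1..n}. spot \<alpha> j \<le> t - 1}"
  have S: "card S = t - 1" using card_spot_le[of "t - 1"] t by (auto simp: S_def)
  have "c \<notin> S" "finite S" using assms t by (auto simp: S_def)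
  have sub: "S \<subseteq> A"
    using spot_unit by (fastforce simp: S_def A_def)
  have rest: "j = c" if "j \<in> A" "j \<notin> S" for j
  proof -
    have "pref \<alpha> j < t" "t \<le> spot \<alpha> j" "j \<in> {1..n}" using that t by (auto simp: A_def S_def)
    then have "spot \<alpha> j = t" using spot_unit[of j] by auto
    then show ?thesis using that spot_eqD assms by (auto simp: A_def)
  qed
  have "c \<in> A \<longleftrightarrow> c \<notin> lucky \<alpha>"
    using spot_unit[of c] assms t by (auto simp: A_def lucky_def length_UPF)
  then have A: "A = (if c \<in> lucky \<alpha> then S else insert c S)"
    using sub rest by auto
  have "card A = (if c \<in> lucky \<alpha> then t - 1 else t)"
    unfolding A using S \<open>c \<notin> S\<close> \<open>finite S\<close> t by simp
  then have lower: "\<not> pref (sort \<alpha>) t \<le> t - 1 \<longleftrightarrow> c \<in> lucky \<alpha>"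
    using sort_pref_le_iff[OF t, of "t - 1"] t by (auto simp: A_def)
  \<comment> \<open>The \<open>t\<close> cars parked in spots up to \<open>t\<close> bound the
    sorted preference at position \<open>t\<close> from above.\<close>
  have "{j \<in> {1..n}. spot \<alpha> j \<le> t} \<subseteq> {j \<in> {1..n}. pref \<alpha> j \<le> t}"
    using spot_unit by fastforce
  from card_mono[OF _ this] have "pref (sort \<alpha>) t \<le> t"
    using card_spot_le[of t] sort_pref_le_iff[OF t, of t] t by auto
  then show ?thesis using lower t by auto
qed

lemma block_starts_eq: "block_starts \<alpha> = sorted_list_of_set (pref \<alpha> ` lucky \<alpha>)"
proof -
  have "t \<in> pref \<alpha> ` lucky \<alpha> \<longleftrightarrow> t \<in> {1..n} \<and> pref (sort \<alpha>) t = t" for t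
  proof
    assume "t \<in> pref \<alpha> ` lucky \<alpha>"
    then show "t \<in> {1..n} \<and> pref (sort \<alpha>) t = t"
      using luckyD sort_pref_fixed_iff pref_in by fastforce
  next
    assume t: "t \<in> {1..n} \<and> pref (sort \<alpha>) t = t"
    then obtain c where "c \<in> {1..n}" "spot \<alpha> c = t"
      using bij_betw_spot unfolding bij_betw_def by (metis imageE)
    then show "t \<in> pref \<alpha> ` lucky \<alpha>"
      using t sort_pref_fixed_iff luckyD by (metis image_eqI)
  qed
  then show ?thesis
    unfolding block_starts_def length_UPF by (intro arg_cong[where f = sorted_list_of_set]) auto
qed

lemma set_block_starts: "set (block_starts \<alpha>) = pref \<alpha> ` lucky \<alpha>"
  by (simp add: block_starts_eq finite_lucky)

text \<open>Both lists are sorted and repetition-free, by injectivity of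
  \<open>pref \<alpha>\<close> on lucky cars, and have the same entries.\<close>

lemma map_pref_lucky_by_pref:
  "map (pref \<alpha>) (sort_key (pref \<alpha>) (sorted_list_of_set (lucky \<alpha>))) = block_starts \<alpha>"
  unfolding block_starts_eq
  by (rule sorted_distinct_set_unique)
    (simp_all add: map_sort_key_eq_sort distinct_map finite_lucky inj_on_pref_lucky)

section \<open>Blocks and their minima\<close>

definition bounds :: "nat list" where
  "bounds = block_starts \<alpha> @ [n + 1]"

definition block :: "nat \<Rightarrow> nat set" where
  "block j = {i \<in> {1..n}. bounds ! j \<le> pref \<alpha> i \<and> pref \<alpha> i < bounds ! Suc j}"

lemma bounds_nth: "j < length (block_starts \<alpha>) \<Longrightarrow> bounds ! j = block_starts \<alpha> ! j"
  by (simp add: bounds_def nth_append)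

lemma bounds_last: "bounds ! length (block_starts \<alpha>) = n + 1"
  by (simp add: bounds_def)

lemma in_block_iff:
  "i \<in> block j \<longleftrightarrow> i \<in> {1..n} \<and> bounds ! j \<le> pref \<alpha> i \<and> pref \<alpha> i < bounds ! Suc j"
  by (simp add: block_def)

lemma phi_eq: "phi \<alpha> = map block [0..<length (block_starts \<alpha>)]"
  by (simp add: phi_def length_UPF Let_def block_def bounds_def)

lemma strict_sorted_bounds: "sorted_wrt (<) bounds"
proof -
  have "\<forall>t\<in>set (block_starts \<alpha>). t < n + 1"
    unfolding set_block_starts using luckyD pref_in by fastforce
  moreover have "sorted_wrt (<) (block_starts \<alpha>)"
    unfolding block_starts_def by (rule strict_sorted_list_of_set)
  ultimately show ?thesis by (simp add: bounds_def sorted_wrt_append)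
qed

lemma bounds_less: "j < k \<Longrightarrow> k \<le> length (block_starts \<alpha>) \<Longrightarrow> bounds ! j < bounds ! k"
  by (rule sorted_wrt_nth_less[OF strict_sorted_bounds]) (simp_all add: bounds_def)

lemma bounds_le: "j \<le> k \<Longrightarrow> k \<le> length (block_starts \<alpha>) \<Longrightarrow> bounds ! j \<le> bounds ! k"
  using bounds_less[of j k] by (cases "j = k") auto

lemma block_unique:
  assumes "i \<in> block j" and "i \<in> block k"
    and "j < length (block_starts \<alpha>)" and "k < length (block_starts \<alpha>)"
  shows "j = k"
proof (rule ccontr)
  assume "j \<noteq> k"
  then consider "Suc j \<le> k" | "Suc k \<le> j" by linarith
  then show False
  proof cases
    case 1
    then show False using bounds_le[of "Suc j" k] assms by (simp add: in_block_iff)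
  next
    case 2
    then show False using bounds_le[of "Suc k" j] assms by (simp add: in_block_iff)
  qed
qed

text \<open>The preference of a lucky car is itself a block start, so the car lies in the block
  opened there; disjointness identifies that block with \<open>block j\<close>.\<close>

lemma lucky_in_block:
  assumes "i \<in> lucky \<alpha>" and "i \<in> block j" and "j < length (block_starts \<alpha>)"
  shows "pref \<alpha> i = bounds ! j"
proof -
  obtain k where k: "k < length (block_starts \<alpha>)" "bounds ! k = pref \<alpha> i"
    using assms(1) set_block_starts by (metis image_eqI in_set_conv_nth bounds_nth)
  have "i \<in> block k"
    using k luckyD[OF assms(1)] bounds_less[of k "Suc k"] by (simp add: in_block_iff)
  then show ?thesis using block_unique assms k by metis
qed

text \<open>Strong induction on the car: an unlucky \<open>i\<close> is preceded by the car
  \<open>l\<close> in its preferred spot, which is either \<open>c\<close> or again a member of the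
  block.\<close>

lemma lucky_le_block:
  assumes c: "c \<in> lucky \<alpha>" "pref \<alpha> c = bounds ! j" and j: "j < length (block_starts \<alpha>)"
  shows "i \<in> block j \<Longrightarrow> c \<le> i"
proof (induction i rule: less_induct)
  case (less i)
  show ?case
  proof (cases "i \<in> lucky \<alpha>")
    case True
    then have "pref \<alpha> i = pref \<alpha> c" using lucky_in_block less.prems j c by metis
    then show ?thesis using True c inj_on_pref_lucky by (metis inj_onD order_refl)
  next
    case False
    then obtain l where l: "l \<in> {1..<i}" "spot \<alpha> l = pref \<alpha> i"
      using unlucky_obtains less.prems by (auto simp: in_block_iff)
    have l': "l \<in> {1..n}" using l less.prems by (simp add: in_block_iff)
    show ?thesis
    proof (cases "pref \<alpha> i = bounds ! j")
      case True
      then have "l = c" using spot_eqD[OF l', of c] luckyD[OF c(1)] c(2) l(2) by simp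
      then show ?thesis using l by auto
    next
      case False
      \<comment> \<open>\<open>l\<close> prefers at most one spot below
        \<open>pref \<alpha> i\<close>, which exceeds the block start, so \<open>l\<close> does not
        fall out of the block.\<close>
      then have "l \<in> block j" using spot_unit[OF l'] l l' less.prems by (auto simp: in_block_iff)
      then show ?thesis using less.IH[of l] l by auto
    qed
  qed
qed

text \<open>The lucky car whose preference opens a block is a lower bound of the block and belongs
  to it.\<close>

lemma map_Min_phi: "map Min (phi \<alpha>) = sort_key (pref \<alpha>) (sorted_list_of_set (lucky \<alpha>))"
proof -
  define w where "w = sort_key (pref \<alpha>) (sorted_list_of_set (lucky \<alpha>))"
  have w: "map (pref \<alpha>) w = block_starts \<alpha>" unfolding w_def by (rule map_pref_lucky_by_pref)
  then have len: "length w = length (block_starts \<alpha>)" by (metis length_map)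
  have "map Min (phi \<alpha>) = w"
  proof (rule nth_equalityI)
    fix j assume "j < length (map Min (phi \<alpha>))"
    then have j: "j < length (block_starts \<alpha>)" by (simp add: phi_eq)
    have "w ! j \<in> set w" using j len by simp
    then have c: "w ! j \<in> lucky \<alpha>" by (simp add: w_def finite_lucky)
    have p: "pref \<alpha> (w ! j) = bounds ! j"
      using j len w by (metis bounds_nth nth_map)
    have "w ! j \<in> block j"
      using luckyD[OF c] p bounds_less[of j "Suc j"] j by (simp add: in_block_iff)
    then have "Min (block j) = w ! j"
      using lucky_le_block[OF c p j] by (intro Min_eqI) (auto simp: block_def)
    then show "map Min (phi \<alpha>) ! j = w ! j" using j by (simp add: phi_eq)
  qed (simp add: phi_eq len)
  then show ?thesis by (simp add: w_def)
qed

section \<open>The blocks form an ordered set partition\<close>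

lemma in_some_block:
  assumes i: "i \<in> {1..n}"
  obtains j where "j < length (block_starts \<alpha>)" and "i \<in> block j"
proof -
  \<comment> \<open>The first block start is at most \<open>1\<close>: the car in spot
    \<open>1\<close> cannot prefer \<open>0\<close>, so it is lucky and \<open>1\<close> is a block
    start.\<close>
  have "1 \<in> {1..n}" using i by auto
  then obtain c where c: "c \<in> {1..n}" "spot \<alpha> c = 1"
    using bij_betw_spot unfolding bij_betw_def by (metis imageE)
  then have "pref \<alpha> c = 1" using spot_unit[of c] pref_in[of c] by auto
  with c have "1 \<in> set (block_starts \<alpha>)"
    unfolding set_block_starts by (force simp: lucky_def length_UPF)
  then obtain k where "k < length (block_starts \<alpha>)" "bounds ! k = 1"
    by (metis in_set_conv_nth bounds_nth)
  then have "bounds ! 0 \<le> 1" using bounds_le[of 0 k] by simp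
  then have "\<not> pref \<alpha> i < bounds ! 0" using pref_in[OF i] by auto
  moreover have "pref \<alpha> i < bounds ! length (block_starts \<alpha>)" using pref_in[OF i] by (simp add: bounds_last)
  \<comment> \<open>The first bound exceeding \<open>pref \<alpha> i\<close> closes the block
    sought; the sentinel \<open>n + 1\<close> ensures that one exists.\<close>
  ultimately obtain j where "j < length (block_starts \<alpha>)"
      "\<forall>k\<le>j. \<not> pref \<alpha> i < bounds ! k" "pref \<alpha> i < bounds ! Suc j"
    using ex_least_nat_less[of "\<lambda>k. pref \<alpha> i < bounds ! k" "length (block_starts \<alpha>)"] by blast
  then show ?thesis using that[of j] i by (simp add: in_block_iff not_less)
qed

lemma distinct_map_Min_phi: "distinct (map Min (phi \<alpha>))"
  by (simp add: map_Min_phi)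

lemma ordered_set_partition_phi: "ordered_set_partition n (phi \<alpha>)"
proof -
  have "partition_on {1..n} (set (phi \<alpha>))"
  proof (rule partition_onI)
    show "\<Union> (set (phi \<alpha>)) = {1..n}"
      using in_some_block by (fastforce simp: phi_eq in_block_iff)
    show "disjnt p q" if pq: "p \<in> set (phi \<alpha>)" "q \<in> set (phi \<alpha>)" "p \<noteq> q" for p q
    proof -
      obtain j k where jk: "p = block j" "j < length (block_starts \<alpha>)"
          "q = block k" "k < length (block_starts \<alpha>)"
        using pq(1,2) by (auto simp: phi_eq)
      then show ?thesis using block_unique[of _ j k] pq(3) unfolding disjnt_def by blast
    qed
    show "{} \<notin> set (phi \<alpha>)"
    proof
      assume "{} \<in> set (phi \<alpha>)"
      then obtain j where j: "j < length (block_starts \<alpha>)" "block j = {}"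
        by (auto simp: phi_eq)
      then obtain c where c: "c \<in> lucky \<alpha>" "pref \<alpha> c = bounds ! j"
        using set_block_starts by (metis imageE bounds_nth nth_mem)
      then have "c \<in> block j" using luckyD[OF c(1)] bounds_less[of j "Suc j"] j(1) by (simp add: in_block_iff)
      then show False using j by blast
    qed
  qed
  \<comment> \<open>Distinct minima force distinct blocks.\<close>
  then show ?thesis
    using distinct_map_Min_phi by (simp add: ordered_set_partition_def distinct_map)
qed

section \<open>Derangement in terms of lucky cars\<close>

lemma map_Min_sort_phi: "map Min (sort_key Min (phi \<alpha>)) = sorted_list_of_set (lucky \<alpha>)"
  \<comment> \<open>Sorting by \<open>Min\<close> and then taking minima amounts to sorting the list
    of minima, whose entries are the lucky cars.\<close>
  unfolding map_sort_key_eq_sort map_Min_phi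
  by (rule sorted_distinct_set_unique) (simp_all add: finite_lucky)

lemma deranged_phi_iff:
  "deranged n (phi \<alpha>) \<longleftrightarrow> (\<forall>k<card (lucky \<alpha>). sorted_list_of_set (lucky \<alpha>) ! k
     \<noteq> sort_key (pref \<alpha>) (sorted_list_of_set (lucky \<alpha>)) ! k)"
proof -
  have inj: "inj_on Min (set (phi \<alpha>))" using distinct_map_Min_phi by (simp add: distinct_map)
  have len: "length (phi \<alpha>) = card (lucky \<alpha>)"
    using arg_cong[OF map_Min_phi, of length] by simp
  \<comment> \<open>Since \<open>Min\<close> is injective on the blocks, comparing blocks is the
    same as comparing minima.\<close>
  have "sort_key Min (phi \<alpha>) ! k \<noteq> phi \<alpha> ! k \<longleftrightarrow>
      map Min (sort_key Min (phi \<alpha>)) ! k \<noteq> map Min (phi \<alpha>) ! k" if "k < length (phi \<alpha>)" for k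
  proof -
    have "sort_key Min (phi \<alpha>) ! k \<in> set (phi \<alpha>)"
      using that by (metis length_sort nth_mem set_sort)
    then show ?thesis using that inj by (simp add: inj_on_eq_iff)
  qed
  then show ?thesis
    unfolding deranged_def Let_def map_Min_sort_phi map_Min_phi len
    using ordered_set_partition_phi by metis
qed

end

theorem theorem3p11:
  fixes n m :: nat and \<alpha> u w :: "nat list"
  assumes "\<alpha> \<in> UPF n"
    and "m = card (lucky \<alpha>)"
    and "u = sorted_list_of_set (lucky \<alpha>)"
    and "w = sort_key (pref \<alpha>) (sorted_list_of_set (lucky \<alpha>))"
  shows "map (pref \<alpha>) w = block_starts \<alpha> \<and>
    (\<alpha> \<in> DUPF n \<longleftrightarrow> (\<forall>k<m. u ! k \<noteq> w ! k))"
  using map_pref_lucky_by_pref[OF assms(1)] deranged_phi_iff[OF assms(1)] assms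
  by (simp add: DUPF_def)

end
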